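(* Let $C_3^{+}$ be the graph obtained from a triangle by attaching a single pendant leaf to one of its vertices. Then $C_3^{+}$ admits no discrete Einstein metric: there is no positive edge weighting of $C_3^+$ for which the Lin--Lu--Yau curvature takes the same value on all four edges.
   Context: Weighted graphs: $G=(V,E)$ is a finite connected simple graph, $w:E\to\mathbb{R}_{>0}$ an edge weighting, $d_v$ the combinatorial degree, and $d(x,y)$ the least total weight of a path from $x$ to $y$. Lin--Lu--Yau curvature: for $\alpha\in[0,1]$ let $\mu_x^\alpha$ be the probability measure with mass $\alpha$ at $x$ and $(1-\alpha)/d_x$ at each neighbour of $x$. Let $W$ be the $L^1$-Wasserstein distance with respect to $d$. For an edge $x\sim y$ put $\kappa_\alpha(x,y)=1-W(\mu_x^\alpha,\mu_y^\alpha)/d(x,y)$ and $\kappa_{xy}=\lim_{\alpha\to1}\kappa_\alpha(x,y)/(1-\alpha)$. A positive weighting $w$ is a discrete Einstein metric if there is a real $\kappa$ with $\kappa_e=\kappa$ for every edge $e$. *)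

theory Defs
  imports "HOL-Probability.Probability" "Graph_Theory.Graph_Theory"
begin

text \<open>
  A simple graph is a \<^locale>\<open>pair_graph\<close>: a finite, loop-free digraph whose arc relation is
  symmetric, an undirected edge \<open>{x, y}\<close> being represented by the two arcs \<open>(x, y)\<close>, \<open>(y, x)\<close>.
  The weighting lives on undirected edges, so it is symmetric by construction.
\<close>

locale weighted_graph = pair_graph G
  for G :: "'v pair_pre_digraph" +
  fixes w :: "'v set \<Rightarrow> real"
  assumes connected: "Digraph_Component.connected (with_proj G)"
    and weight_pos: "(x, y) \<in> parcs G \<Longrightarrow> 0 < w {x, y}"

text \<open>
  The measure \<open>\<mu>\<^sub>x\<^sup>\<alpha>\<close>; meaningful for \<open>0 \<le> \<alpha> \<le> 1\<close> and \<open>x\<close> of positive degree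
  (see \<open>pmf_lazy_walk\<close>). The out-degree of a symmetric digraph is the combinatorial degree.
\<close>

definition (in pair_graph) lazy_walk :: "real \<Rightarrow> 'a \<Rightarrow> 'a pmf" where
  "lazy_walk \<alpha> x = embed_pmf (\<lambda>z.
     if z = x then \<alpha>
     else if (x, z) \<in> parcs G then (1 - \<alpha>) / real (out_degree (with_proj G) x)
     else 0)"

lemma (in pair_graph) pmf_lazy_walk:
  assumes "0 \<le> \<alpha>" "\<alpha> \<le> 1" and "(x, y) \<in> parcs G"
  shows "pmf (lazy_walk \<alpha> x) z =
    (if z = x then \<alpha>
     else if (x, z) \<in> parcs G then (1 - \<alpha>) / real (out_degree (with_proj G) x)
     else 0)"
proof -
  let ?N = "{z. (x, z) \<in> parcs G}" and ?d = "out_degree (with_proj G) x"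
  let ?f = "\<lambda>z. if z = x then \<alpha> else if (x, z) \<in> parcs G then (1 - \<alpha>) / real ?d else 0"
  have out: "out_arcs (with_proj G) x = Pair x ` ?N"
    by (auto simp: out_arcs_def)
  have d: "?d = card ?N"
    unfolding out_degree_def out by (rule card_image) (auto simp: inj_on_def)
  have fin: "finite ?N"
    by (rule finite_subset[OF _ pair_finite_verts]) (auto dest: in_arcsD2)
  have x: "x \<notin> ?N"
    by (auto dest: no_loops')
  have "?N \<noteq> {}"
    using assms(3) by auto
  then have d0: "real ?d > 0"
    using fin by (simp add: d card_gt_0_iff)
  have nonneg: "0 \<le> ?f z" for z
    using assms(1,2) by auto
  have "(\<integral>\<^sup>+ z. ennreal (?f z) \<partial>count_space UNIV) = (\<Sum>z\<in>insert x ?N. ennreal (?f z))"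
    by (rule nn_integral_count_space'[where A = "insert x ?N"]) (use fin in auto)
  also have "\<dots> = ennreal (\<Sum>z\<in>insert x ?N. ?f z)"
    by (rule sum_ennreal) (rule nonneg)
  also have "(\<Sum>z\<in>insert x ?N. ?f z) = \<alpha> + (\<Sum>z\<in>?N. ?f z)"
    using fin x by simp
  also have "(\<Sum>z\<in>?N. ?f z) = (\<Sum>z\<in>?N. (1 - \<alpha>) / real ?d)"
    by (rule sum.cong) (use x in auto)
  also have "\<alpha> + \<dots> = 1"
    using d0 by (simp add: d)
  finally show ?thesis
    unfolding lazy_walk_def using nonneg by (subst pmf_embed_pmf) auto
qed

definition wasserstein :: "('v \<Rightarrow> 'v \<Rightarrow> real) \<Rightarrow> 'v pmf \<Rightarrow> 'v pmf \<Rightarrow> real" where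
  "wasserstein d \<mu> \<nu> =
     (INF \<pi>\<in>{\<pi>. map_pmf fst \<pi> = \<mu> \<and> map_pmf snd \<pi> = \<nu>}.
        measure_pmf.expectation \<pi> (\<lambda>(x, y). d x y))"

context weighted_graph
begin

definition graph_dist :: "'v \<Rightarrow> 'v \<Rightarrow> real" where
  "graph_dist x y = (INF p\<in>{p. apath x p y}. awalk_cost (\<lambda>(u, v). w {u, v}) p)"

definition lazy_curvature :: "real \<Rightarrow> 'v \<Rightarrow> 'v \<Rightarrow> real" where
  "lazy_curvature \<alpha> x y =
     1 - wasserstein graph_dist (lazy_walk \<alpha> x) (lazy_walk \<alpha> y) / graph_dist x y"

definition lly_curvature :: "'v \<Rightarrow> 'v \<Rightarrow> real" where
  "lly_curvature x y = Lim (at_left 1) (\<lambda>\<alpha>. lazy_curvature \<alpha> x y / (1 - \<alpha>))"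

end

definition discrete_einstein_metric :: "'v pair_pre_digraph \<Rightarrow> ('v set \<Rightarrow> real) \<Rightarrow> bool" where
  "discrete_einstein_metric G w \<longleftrightarrow>
     weighted_graph G w \<and>
     (\<exists>\<kappa>. \<forall>(x, y)\<in>parcs G. weighted_graph.lly_curvature G w x y = \<kappa>)"

text \<open>The triangle \<open>a b c\<close> with a pendant leaf \<open>l\<close> at \<open>a\<close>.\<close>

definition C3_plus :: "'v \<Rightarrow> 'v \<Rightarrow> 'v \<Rightarrow> 'v \<Rightarrow> 'v pair_pre_digraph" where
  "C3_plus a b c l =
     \<lparr> pverts = {a, b, c, l}, parcs = symcl {(a, b), (b, c), (c, a), (a, l)} \<rparr>"

text \<open>
  The conjunct \<^term>\<open>weighted_graph G w\<close> in \<^const>\<open>discrete_einstein_metric\<close> constrains only the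
  weighting of \<^const>\<open>C3_plus\<close>, not the graph.
\<close>

lemma weighted_graph_C3_plus_iff:
  assumes "distinct [a, b, c, l]"
  shows "weighted_graph (C3_plus a b c l) w \<longleftrightarrow>
    0 < w {a, b} \<and> 0 < w {b, c} \<and> 0 < w {c, a} \<and> 0 < w {a, l}"
proof -
  let ?G = "C3_plus a b c l"
  interpret G: pair_graph ?G
    by unfold_locales
      (use assms in \<open>auto simp: C3_plus_def symcl_def symmetric_def intro!: symI\<close>)
  have reach: "a \<rightarrow>\<^sup>*\<^bsub>with_proj ?G\<^esub> x \<and> x \<rightarrow>\<^sup>*\<^bsub>with_proj ?G\<^esub> a" if "x \<in> pverts ?G" for x
  proof (cases "x = a")
    case True
    with that show ?thesis by simp
  next
    case False
    with that have "(a, x) \<in> parcs ?G" "(x, a) \<in> parcs ?G"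
      by (auto simp: C3_plus_def symcl_def)
    then show ?thesis
      using G.reachable_adjI by simp
  qed
  have "Digraph_Component.connected (with_proj ?G)"
    unfolding Digraph_Component.connected_def
  proof (rule strongly_connectedI)
    show "verts (with_proj (mk_symmetric (with_proj ?G))) \<noteq> {}"
      by (simp add: C3_plus_def mk_symmetric_def)
  next
    fix u v
    assume "u \<in> verts (with_proj (mk_symmetric (with_proj ?G)))"
      and "v \<in> verts (with_proj (mk_symmetric (with_proj ?G)))"
    then have "u \<rightarrow>\<^sup>*\<^bsub>with_proj ?G\<^esub> a" "a \<rightarrow>\<^sup>*\<^bsub>with_proj ?G\<^esub> v"
      using reach by (auto simp: mk_symmetric_def)
    then have "u \<rightarrow>\<^sup>*\<^bsub>with_proj ?G\<^esub> v"
      by (rule G.reachable_trans)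
    then show "u \<rightarrow>\<^sup>*\<^bsub>with_proj (mk_symmetric (with_proj ?G))\<^esub> v"
      by (rule G.reachable_mk_symmetricI)
  qed
  then show ?thesis
    using G.pair_graph
    by (auto simp: weighted_graph_def weighted_graph_axioms_def C3_plus_def symcl_def
        insert_commute)
qed

end

theory Submission
  imports Defs
begin

text \<open>
  For each of the edges \<open>b c\<close> and \<open>a l\<close>, the lazy walk at the first endpoint dominates the one at
  the second away from the second endpoint, so an optimal plan only moves mass straight to that
  endpoint. Whatever the weights, this gives \<open>\<kappa> = 3 / 2\<close> on \<open>b c\<close>, whereas on the pendant edge it
  gives \<open>\<kappa> = 2 - (d b l + d c l) / (3 * d a l) \<le> 4 / 3\<close>, since every path to \<open>l\<close> ends with \<open>a l\<close>.
\<close>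

section \<open>Optimal transport towards a single point\<close>

lemma pmf_eqI_except:
  assumes "\<And>x. x \<noteq> t \<Longrightarrow> pmf p x = pmf q x"
  shows "p = q"
proof (rule pmf_eqI)
  fix x
  have eq: "measure_pmf.prob p (- {t}) = measure_pmf.prob q (- {t})"
    unfolding measure_pmf_conv_infsetsum by (rule infsetsum_cong) (use assms in auto)
  have "pmf r t = 1 - measure_pmf.prob r (- {t})" for r
    using measure_pmf.prob_compl[of "{t}" r] by (simp add: measure_pmf_single Compl_eq_Diff_UNIV)
  with eq assms show "pmf p x = pmf q x"
    by (cases "x = t") auto
qed

text \<open>
  The optimal plan leaves mass \<open>\<nu> x\<close> at each \<open>x \<noteq> t\<close> and sends the excess \<open>\<mu> x - \<nu> x\<close> to \<open>t\<close>;
  the 1-Lipschitz function \<open>\<lambda>x. d x t\<close> certifies optimality.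
\<close>

lemma wasserstein_to_point:
  fixes d :: "'v \<Rightarrow> 'v \<Rightarrow> real"
  assumes fin: "finite (set_pmf \<mu>)" "finite (set_pmf \<nu>)"
    and le: "\<And>x. x \<noteq> t \<Longrightarrow> pmf \<nu> x \<le> pmf \<mu> x"
    and self: "\<And>x. x \<in> set_pmf \<mu> \<union> set_pmf \<nu> \<Longrightarrow> d x x = 0"
    and tri: "\<And>x y. x \<in> set_pmf \<mu> \<Longrightarrow> y \<in> set_pmf \<nu> \<Longrightarrow> d x t \<le> d x y + d y t"
    and t: "t \<in> set_pmf \<nu>"
  shows "wasserstein d \<mu> \<nu> =
    measure_pmf.expectation \<mu> (\<lambda>x. d x t) - measure_pmf.expectation \<nu> (\<lambda>x. d x t)"
proof -
  let ?E = measure_pmf.expectation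
  let ?C = "{\<pi>. map_pmf fst \<pi> = \<mu> \<and> map_pmf snd \<pi> = \<nu>}"
  let ?W = "?E \<mu> (\<lambda>x. d x t) - ?E \<nu> (\<lambda>x. d x t)"
  have fin_plan: "finite (set_pmf \<pi>)" if "\<pi> \<in> ?C" for \<pi>
  proof (rule finite_subset)
    show "set_pmf \<pi> \<subseteq> set_pmf \<mu> \<times> set_pmf \<nu>"
      using that by (force simp: set_map_pmf)
  qed (use fin in simp)
  \<comment> \<open>Since \<open>?W\<close> depends only on the marginals, it is one and the same
    integral over every plan; both optimality bounds then reduce to pointwise comparisons on the
    support of the plan.\<close>
  have W: "?W = ?E \<pi> (\<lambda>(x, y). d x t - d y t)" if "\<pi> \<in> ?C" for \<pi>
  proof -
    have "?W = ?E \<pi> (\<lambda>z. d (fst z) t) - ?E \<pi> (\<lambda>z. d (snd z) t)"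
      using that by auto
    also have "\<dots> = ?E \<pi> (\<lambda>(x, y). d x t - d y t)"
      using fin_plan[OF that]
      by (simp add: split_beta' integrable_measure_pmf_finite)
    finally show ?thesis .
  qed
  have lower: "?W \<le> ?E \<pi> (\<lambda>(x, y). d x y)" if "\<pi> \<in> ?C" for \<pi>
    unfolding W[OF that]
  proof (rule integral_mono_AE)
    show "AE z in \<pi>. (case z of (x, y) \<Rightarrow> d x t - d y t) \<le> (case z of (x, y) \<Rightarrow> d x y)"
    proof (rule AE_pmfI)
      fix z assume "z \<in> set_pmf \<pi>"
      with that have "fst z \<in> set_pmf \<mu>" "snd z \<in> set_pmf \<nu>"
        by auto
      from tri[OF this]
      show "(case z of (x, y) \<Rightarrow> d x t - d y t) \<le> (case z of (x, y) \<Rightarrow> d x y)"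
        by (auto simp: case_prod_beta)
    qed
  qed (use fin_plan[OF that] in \<open>auto intro: integrable_measure_pmf_finite\<close>)
  \<comment> \<open>Transport kernel: a unit at \<open>x\<close> stays with probability
    \<open>pmf \<nu> x / pmf \<mu> x\<close> and otherwise jumps to \<open>t\<close>; a unit at
    \<open>t\<close> never moves.\<close>
  define K where "K x = (if x = t then return_pmf t else
    map_pmf (\<lambda>B. if B then x else t) (bernoulli_pmf (pmf \<nu> x / pmf \<mu> x)))" for x
  define \<pi> where "\<pi> = bind_pmf \<mu> (\<lambda>x. map_pmf (Pair x) (K x))"
  have K: "pmf (K x) z = (if x = z then pmf \<nu> z / pmf \<mu> z else 0)"
    if z: "z \<noteq> t" and x: "x \<in> set_pmf \<mu>" for x z
  proof (cases "x = t")
    case True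
    with z show ?thesis
      by (simp add: K_def)
  next
    case False
    \<comment> \<open>Domination puts the ratio in [0, 1], where \<open>bernoulli_pmf\<close> does
      not truncate its parameter.\<close>
    with x le[of x] have p: "0 \<le> pmf \<nu> x / pmf \<mu> x" "pmf \<nu> x / pmf \<mu> x \<le> 1"
      by (auto simp: divide_le_eq_1 pmf_positive)
    have "(\<lambda>B. if B then x else t) -` {z} = (if x = z then {True} else {})"
      using z by (auto split: if_splits)
    from pmf_bernoulli_True[OF p] False this show ?thesis
      by (auto simp: K_def pmf_map measure_pmf_single)
  qed
  have "map_pmf snd \<pi> = \<nu>"
  \<comment> \<open>The value at \<open>t\<close> is forced by total mass 1, so the mass arriving at
    \<open>t\<close> never has to be summed.\<close>
  proof (rule pmf_eqI_except)
    fix z assume z: "z \<noteq> t"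
    have "pmf (map_pmf snd \<pi>) z = ?E \<mu> (\<lambda>x. pmf (K x) z)"
      by (simp add: \<pi>_def map_bind_pmf map_pmf_comp pmf_bind)
    also have "\<dots> = (\<Sum>x\<in>set_pmf \<mu>. pmf (K x) z * pmf \<mu> x)"
      by (rule integral_measure_pmf_real) (use fin in auto)
    also have "\<dots> = (\<Sum>x\<in>set_pmf \<mu>. if x = z then pmf \<nu> z else 0)"
      by (rule sum.cong) (auto simp: K[OF z] set_pmf_iff)
    also have "\<dots> = (if z \<in> set_pmf \<mu> then pmf \<nu> z else 0)"
      using fin by simp
    \<comment> \<open>Off the support of \<mu>, domination forces \<nu> to vanish as well.\<close>
    also have "\<dots> = pmf \<nu> z"
      using le[OF z] pmf_nonneg[of \<nu> z] by (auto simp: set_pmf_iff)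
    finally show "pmf (map_pmf snd \<pi>) z = pmf \<nu> z" .
  qed
  moreover have "map_pmf fst \<pi> = \<mu>"
    by (simp add: \<pi>_def map_bind_pmf map_pmf_comp map_pmf_const bind_return_pmf')
  ultimately have plan: "\<pi> \<in> ?C"
    by simp
  \<comment> \<open>The triangle inequality is tight on this plan: its pairs have the form (x, x) or
    (x, t), and both \<open>d x x\<close> and \<open>d t t\<close> are 0.\<close>
  have "?W = ?E \<pi> (\<lambda>(x, y). d x y)"
    unfolding W[OF plan]
  proof (rule integral_cong_AE)
    show "AE z in \<pi>. (case z of (x, y) \<Rightarrow> d x t - d y t) = (case z of (x, y) \<Rightarrow> d x y)"
    proof (rule AE_pmfI)
      fix z assume "z \<in> set_pmf \<pi>"
      then have "fst z \<in> set_pmf \<mu>" "snd z = fst z \<or> snd z = t"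
        by (auto simp: \<pi>_def K_def split: if_splits)
      with self t show "(case z of (x, y) \<Rightarrow> d x t - d y t) = (case z of (x, y) \<Rightarrow> d x y)"
        by (auto simp: case_prod_beta)
    qed
  qed auto
  with plan have "?W \<in> (\<lambda>\<pi>. ?E \<pi> (\<lambda>(x, y). d x y)) ` ?C"
    by (rule rev_image_eqI)
  then show ?thesis
    unfolding wasserstein_def by (rule cInf_eq_minimum) (use lower in auto)
qed

section \<open>Support and expectation of the lazy walk\<close>

context pair_graph
begin

abbreviation nbrs :: "'a \<Rightarrow> 'a set" where
  "nbrs x \<equiv> {z. (x, z) \<in> parcs G}"

lemma finite_nbrs: "finite (nbrs x)"
  by (rule finite_subset[OF _ pair_finite_verts]) (auto dest: in_arcsD2)

lemma out_degree_eq_card_nbrs: "out_degree (with_proj G) x = card (nbrs x)"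
proof -
  have "out_arcs (with_proj G) x = Pair x ` nbrs x"
    by (auto simp: out_arcs_def)
  then show ?thesis
    unfolding out_degree_def by (simp add: card_image inj_on_def)
qed

text \<open>Only an inclusion: \<alpha> = 0 drops the centre and \<alpha> = 1 drops the
  neighbours.\<close>

lemma set_lazy_walk_subset:
  assumes "0 \<le> \<alpha>" "\<alpha> \<le> 1" "(x, y) \<in> parcs G"
  shows "set_pmf (lazy_walk \<alpha> x) \<subseteq> insert x (nbrs x)"
  by (auto simp: set_pmf_iff pmf_lazy_walk[OF assms] split: if_splits)

lemma expectation_lazy_walk:
  fixes f :: "'a \<Rightarrow> real"
  assumes "0 \<le> \<alpha>" "\<alpha> \<le> 1" "(x, y) \<in> parcs G"
  shows "measure_pmf.expectation (lazy_walk \<alpha> x) f =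
    \<alpha> * f x + (1 - \<alpha>) * ((\<Sum>z\<in>nbrs x. f z) / card (nbrs x))"
proof -
  have x: "x \<notin> nbrs x"
    by (auto dest: no_loops')
  have "measure_pmf.expectation (lazy_walk \<alpha> x) f =
      (\<Sum>z\<in>insert x (nbrs x). f z * pmf (lazy_walk \<alpha> x) z)"
    using set_lazy_walk_subset[OF assms]
    by (intro integral_measure_pmf_real) (auto simp: finite_nbrs)
  also have "\<dots> = \<alpha> * f x + (\<Sum>z\<in>nbrs x. f z * pmf (lazy_walk \<alpha> x) z)"
    using x by (simp add: finite_nbrs pmf_lazy_walk[OF assms])
  also have "(\<Sum>z\<in>nbrs x. f z * pmf (lazy_walk \<alpha> x) z) =
      (\<Sum>z\<in>nbrs x. (1 - \<alpha>) / card (nbrs x) * f z)"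
    using x by (intro sum.cong)
      (auto simp: pmf_lazy_walk[OF assms] out_degree_eq_card_nbrs)
  finally show ?thesis
    by (simp add: sum_distrib_left sum_divide_distrib)
qed

end

section \<open>Shortest-path distance and curvature of dominated edges\<close>

context weighted_graph
begin

abbreviation cost :: "('v \<times> 'v) awalk \<Rightarrow> real" where
  "cost \<equiv> awalk_cost (\<lambda>(u, v). w {u, v})"

lemma cost_nonneg: "awalk x p y \<Longrightarrow> 0 \<le> cost p"
  by (rule pos_cost_pos_awalk_cost) (auto dest: weight_pos)

lemma reachable_if_in_verts:
  assumes "x \<in> pverts G" "y \<in> pverts G"
  shows "x \<rightarrow>\<^sup>*\<^bsub>with_proj G\<^esub> y"
  using symmetric_connected_imp_strongly_connected[OF sym_arcs connected] assms
  by (auto elim: strongly_connectedE)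

text \<open>Positive weights let some path attain the infimum over all walks, so restricting to
  paths loses nothing. Bounds may then use arbitrary walks, and concatenation needs no loop
  removal.\<close>

lemma graph_dist_eq_mu:
  assumes "x \<in> pverts G" "y \<in> pverts G"
  shows "\<exists>p. apath x p y \<and> graph_dist x y = cost p" (is ?A)
    and "ereal (graph_dist x y) = \<mu> (\<lambda>(u, v). w {u, v}) x y" (is ?B)
proof -
  obtain p where p: "apath x p y" "\<mu> (\<lambda>(u, v). w {u, v}) x y = cost p"
    using min_cost_awalk[OF reachable_if_in_verts[OF assms], of "\<lambda>(u, v). w {u, v}"]
    by (force dest: weight_pos)
  have "cost p \<le> cost q" if "apath x q y" for q
    using min_cost_le_walk_cost[of x q y "\<lambda>(u, v). w {u, v}"] that p(2)
    by (simp add: apath_def)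
  with p(1) have "graph_dist x y = cost p"
    unfolding graph_dist_def by (intro cInf_eq_minimum) auto
  with p show ?A ?B
    by auto
qed

lemma graph_dist_le:
  assumes "awalk x p y"
  shows "graph_dist x y \<le> cost p"
proof -
  have "x \<in> pverts G" "y \<in> pverts G"
    using assms by auto
  from graph_dist_eq_mu(2)[OF this] min_cost_le_walk_cost[OF assms, of "\<lambda>(u, v). w {u, v}"]
  show ?thesis
    by (metis ereal_less_eq(3))
qed

lemma graph_dist_awalk:
  assumes "x \<in> pverts G" "y \<in> pverts G"
  obtains p where "awalk x p y" "graph_dist x y = cost p"
  using graph_dist_eq_mu(1)[OF assms] by (auto simp: apath_def)

lemma graph_dist_self:
  assumes "x \<in> pverts G"
  shows "graph_dist x x = 0"
proof (rule antisym)
  show "graph_dist x x \<le> 0"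
    using graph_dist_le[of x "[]" x] assms by (simp add: awalk_Nil_iff)
  show "0 \<le> graph_dist x x"
    using graph_dist_awalk[OF assms assms] cost_nonneg by metis
qed

lemma graph_dist_triangle:
  assumes "x \<in> pverts G" "y \<in> pverts G" "z \<in> pverts G"
  shows "graph_dist x z \<le> graph_dist x y + graph_dist y z"
proof -
  obtain p where p: "awalk x p y" "graph_dist x y = cost p"
    using graph_dist_awalk assms by blast
  obtain q where q: "awalk y q z" "graph_dist y z = cost q"
    using graph_dist_awalk assms by blast
  show ?thesis
    using graph_dist_le[OF awalk_appendI[OF p(1) q(1)]] p(2) q(2) by simp
qed

text \<open>A cheapest walk between distinct vertices is non-empty, and its first arc already has
  positive weight.\<close>

lemma graph_dist_pos:
  assumes "x \<in> pverts G" "y \<in> pverts G" "x \<noteq> y"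
  shows "0 < graph_dist x y"
proof -
  obtain p where p: "awalk x p y" "graph_dist x y = cost p"
    using graph_dist_awalk assms by blast
  then obtain u v q where "p = (u, v) # q"
    using assms(3) by (cases p) (auto simp: awalk_Nil_iff)
  with p have "(u, v) \<in> parcs G" "awalk v q y" "graph_dist x y = w {u, v} + cost q"
    by (auto simp: awalk_Cons_iff)
  then show ?thesis
    using weight_pos cost_nonneg by (metis add_pos_nonneg)
qed

text \<open>The last arc of any walk entering the leaf from elsewhere is \<open>(a, y)\<close>,
  whose weight bounds \<open>graph_dist a y\<close>; the rest of the walk costs at least 0.\<close>

lemma graph_dist_leaf:
  assumes x: "x \<in> pverts G" "x \<noteq> y" and arc: "(a, y) \<in> parcs G"
    and leaf: "\<And>u. (u, y) \<in> parcs G \<Longrightarrow> u = a"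
  shows "graph_dist a y \<le> graph_dist x y"
proof -
  have "y \<in> pverts G"
    using arc by (auto dest: in_arcsD2)
  then obtain p where p: "awalk x p y" "graph_dist x y = cost p"
    using graph_dist_awalk x by blast
  then obtain q u v where q: "p = q @ [(u, v)]"
    using x(2) by (cases p rule: rev_cases) (auto simp: awalk_Nil_iff)
  with p have "awalk u [(u, v)] y" "awalk x q u"
    by (auto simp: awalk_append_iff awalk_Cons_iff)
  then have "u = a" "v = y" "0 \<le> cost q"
    using leaf cost_nonneg by (auto simp: awalk_Cons_iff awalk_Nil_iff)
  moreover have "graph_dist a y \<le> cost [(a, y)]"
    by (rule graph_dist_le)
      (use arc in \<open>auto simp: awalk_Cons_iff awalk_Nil_iff dest: in_arcsD1 in_arcsD2\<close>)
  ultimately show ?thesis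
    using p q by simp
qed

text \<open>
  Under the neighbourhood condition the measure at \<open>x\<close> dominates the measure at \<open>y\<close> away from
  \<open>y\<close> as soon as \<open>\<alpha> \<ge> 1 / 2\<close>, so it is optimal to move the excess mass straight to \<open>y\<close>.
\<close>

lemma lly_curvature_dominated:
  assumes arc: "(x, y) \<in> parcs G"
    and dom: "\<And>z. (y, z) \<in> parcs G \<Longrightarrow> z \<noteq> x \<Longrightarrow>
      (x, z) \<in> parcs G \<and> card (nbrs x) \<le> card (nbrs y)"
  shows "lly_curvature x y = 1 +
    ((\<Sum>z\<in>nbrs y. graph_dist z y) / card (nbrs y) -
     (\<Sum>z\<in>nbrs x. graph_dist z y) / card (nbrs x)) / graph_dist x y"
    (is "_ = 1 + (?my - ?mx) / ?d")
proof -
  have arc': "(y, x) \<in> parcs G"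
    using arc arcs_symmetric by blast
  have xy: "x \<in> pverts G" "y \<in> pverts G" "x \<noteq> y"
    using arc by (auto dest: in_arcsD1 in_arcsD2 no_loops')
  have d: "?d > 0"
    by (rule graph_dist_pos) (rule xy)+
  have degx: "card (nbrs x) > 0" and degy: "card (nbrs y) > 0"
    using arc arc' finite_nbrs by (auto simp: card_gt_0_iff)
  have curv: "lazy_curvature \<alpha> x y / (1 - \<alpha>) = 1 + (?my - ?mx) / ?d"
    if \<alpha>: "1 / 2 < \<alpha>" "\<alpha> < 1" for \<alpha>
  proof -
    have \<alpha>': "0 \<le> \<alpha>" "\<alpha> \<le> 1"
      using \<alpha> by auto
    note pmf_x = pmf_lazy_walk[OF \<alpha>' arc] and pmf_y = pmf_lazy_walk[OF \<alpha>' arc']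
    note sub_x = set_lazy_walk_subset[OF \<alpha>' arc] and sub_y = set_lazy_walk_subset[OF \<alpha>' arc']
    have verts: "z \<in> pverts G" if "z \<in> set_pmf (lazy_walk \<alpha> x) \<union> set_pmf (lazy_walk \<alpha> y)" for z
      using that sub_x sub_y xy by (auto dest: in_arcsD2)
    have "wasserstein graph_dist (lazy_walk \<alpha> x) (lazy_walk \<alpha> y) =
        measure_pmf.expectation (lazy_walk \<alpha> x) (\<lambda>z. graph_dist z y) -
        measure_pmf.expectation (lazy_walk \<alpha> y) (\<lambda>z. graph_dist z y)"
    proof (rule wasserstein_to_point)
      show "finite (set_pmf (lazy_walk \<alpha> x))" "finite (set_pmf (lazy_walk \<alpha> y))"
        using sub_x sub_y finite_nbrs finite_subset by (metis finite_insert)+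
      show "pmf (lazy_walk \<alpha> y) z \<le> pmf (lazy_walk \<alpha> x) z" if "z \<noteq> y" for z
      proof (cases "z = x")
        case True
        \<comment> \<open>Here \<alpha> > 1 / 2 enters: the mass at \<open>x\<close> seen from
          \<open>y\<close> is at most 1 - \<alpha>, hence below \<alpha>.\<close>
        have "(1 - \<alpha>) / card (nbrs y) \<le> (1 - \<alpha>) / 1"
          using degy \<alpha> by (intro divide_left_mono) auto
        with True xy arc' \<alpha> show ?thesis
          by (simp add: pmf_x pmf_y out_degree_eq_card_nbrs)
      next
        case False
        with that dom[of z] degx \<alpha> show ?thesis
          by (auto simp: pmf_x pmf_y out_degree_eq_card_nbrs intro!: divide_left_mono)
      qed
      show "y \<in> set_pmf (lazy_walk \<alpha> y)"
        using \<alpha> by (simp add: set_pmf_iff pmf_y)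
    qed (use verts xy in \<open>auto intro: graph_dist_self graph_dist_triangle\<close>)
    also have "\<dots> = \<alpha> * ?d + (1 - \<alpha>) * (?mx - ?my)"
      by (simp add: expectation_lazy_walk[OF \<alpha>' arc] expectation_lazy_walk[OF \<alpha>' arc']
          graph_dist_self xy right_diff_distrib)
    finally have "lazy_curvature \<alpha> x y = (1 - \<alpha>) * (1 + (?my - ?mx) / ?d)"
      unfolding lazy_curvature_def using d by (simp add: field_simps)
    then show ?thesis
      using \<alpha> by simp
  qed
  \<comment> \<open>The quotient is constant on (1 / 2, 1), so its left limit at 1 is that
    constant.\<close>
  have "\<forall>\<^sub>F \<alpha> in at_left 1. lazy_curvature \<alpha> x y / (1 - \<alpha>) = 1 + (?my - ?mx) / ?d"
    unfolding eventually_at_left_field by (rule exI[of _ "1 / 2"]) (use curv in auto)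
  then have "((\<lambda>\<alpha>. lazy_curvature \<alpha> x y / (1 - \<alpha>)) \<longlongrightarrow> 1 + (?my - ?mx) / ?d) (at_left 1)"
    by (rule tendsto_eventually)
  then show ?thesis
    unfolding lly_curvature_def by (intro tendsto_Lim) auto
qed

end

section \<open>Comparison of two edges of the triangle with a leaf\<close>

theorem mainTheorem4:
  fixes a b c l :: 'v
  assumes "distinct [a, b, c, l]"
  shows "\<not> (\<exists>w. discrete_einstein_metric (C3_plus a b c l) w)"
proof
  let ?G = "C3_plus a b c l"
  assume "\<exists>w. discrete_einstein_metric ?G w"
  then obtain w \<kappa> where w: "weighted_graph ?G w"
    and \<kappa>: "\<And>x y. (x, y) \<in> parcs ?G \<Longrightarrow> weighted_graph.lly_curvature ?G w x y = \<kappa>"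
    unfolding discrete_einstein_metric_def by blast
  interpret weighted_graph ?G w
    by (rule w)
  note ne = assms[simplified]
  have verts: "pverts ?G = {a, b, c, l}"
    by (simp add: C3_plus_def)
  have nbrs: "nbrs a = {b, c, l}" "nbrs b = {a, c}" "nbrs c = {a, b}" "nbrs l = {a}"
    using ne by (auto simp: C3_plus_def symcl_def)
  have curv_bc: "lly_curvature b c = 1 +
      ((\<Sum>z\<in>nbrs c. graph_dist z c) / card (nbrs c) -
       (\<Sum>z\<in>nbrs b. graph_dist z c) / card (nbrs b)) / graph_dist b c"
  \<comment> \<open>The only neighbour of \<open>c\<close> besides \<open>b\<close> is
    \<open>a\<close>, which is adjacent to \<open>b\<close> too; \<open>b\<close> and
    \<open>c\<close> both have degree 2.\<close>
  proof (rule lly_curvature_dominated)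
    show "(b, c) \<in> parcs ?G"
      by (simp add: C3_plus_def symcl_def)
    show "(b, z) \<in> parcs ?G \<and> card (nbrs b) \<le> card (nbrs c)"
      if "(c, z) \<in> parcs ?G" "z \<noteq> b" for z
      unfolding nbrs using that ne by (auto simp: C3_plus_def symcl_def)
  qed
  have curv_al: "lly_curvature a l = 1 +
      ((\<Sum>z\<in>nbrs l. graph_dist z l) / card (nbrs l) -
       (\<Sum>z\<in>nbrs a. graph_dist z l) / card (nbrs a)) / graph_dist a l"
  \<comment> \<open>The leaf has no neighbour besides \<open>a\<close>, so the neighbourhood
    condition is vacuous.\<close>
  proof (rule lly_curvature_dominated)
    show "(a, l) \<in> parcs ?G"
      by (simp add: C3_plus_def symcl_def)
    show "(a, z) \<in> parcs ?G \<and> card (nbrs a) \<le> card (nbrs l)"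
      if "(l, z) \<in> parcs ?G" "z \<noteq> a" for z
      using that ne by (auto simp: C3_plus_def symcl_def)
  qed
  have "lly_curvature b c = 3 / 2"
  proof -
    have "0 < graph_dist b c"
      by (rule graph_dist_pos) (use ne verts in auto)
    moreover have "graph_dist c c = 0"
      by (rule graph_dist_self) (simp add: verts)
    \<comment> \<open>The distance from \<open>a\<close> to \<open>c\<close> occurs in both averages
      and cancels, leaving half of \<open>graph_dist b c\<close>.\<close>
    ultimately show ?thesis
      unfolding curv_bc nbrs using ne by (simp add: field_simps)
  qed
  moreover have "lly_curvature a l \<le> 4 / 3"
  proof -
    have "0 < graph_dist a l"
      by (rule graph_dist_pos) (use ne verts in auto)
    moreover have "graph_dist l l = 0"
      by (rule graph_dist_self) (simp add: verts)
    \<comment> \<open>These make the average over \<open>nbrs a\<close> at least 2 / 3 of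
      \<open>graph_dist a l\<close>, whence 1 + 1 - 2 / 3 = 4 / 3.\<close>
    moreover have "graph_dist a l \<le> graph_dist b l" "graph_dist a l \<le> graph_dist c l"
      by (rule graph_dist_leaf; use ne verts in \<open>auto simp: C3_plus_def symcl_def\<close>)+
    ultimately show ?thesis
      unfolding curv_al nbrs using ne by (simp add: field_simps)
  qed
  moreover have "lly_curvature b c = \<kappa>" "lly_curvature a l = \<kappa>"
    by (rule \<kappa>, simp add: C3_plus_def symcl_def)+
  ultimately show False
    by simp
qed

end
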